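(* For every $d\ge 1$ and every $k\ge 2$, $$\sigma_k(Q_d)\le\left\lfloor\frac{d+3}{2}\right\rfloor .$$
   Context: For a graph $G$ and a vertex $x$, $N(x)$ is the open neighbourhood and $N[x]=N(x)\cup\{x\}$ the closed neighbourhood. $[q]=\{1,\dots,q\}$. Let $I\subseteq V(G)$ be an independent set and $k\ge 0$. An attack is a set $S\subseteq I$ with $|S|\le k$. A surjective proper colouring $c:V(G)\to[q]$ (adjacent vertices get different colours), with colour classes $C_i=c^{-1}(i)$, is an $(I,k,q)$-defensive silver colouring if for every colour $i\in[q]$ and every attack $S\subseteq I$ there is an injective map $f_{i,S}:S\to C_i$ with $f_{i,S}(x)\in N[x]$ for every $x\in S$. $\sigma_k(G,I)$ denotes the largest $q$ for which $G$ has an $(I,k,q)$-defensive silver colouring. The hypercube $Q_d$ is the graph on $\mathbb F_2^d$ in which two vertices are adjacent when they differ in exactly one coordinate. Its parity classes are the set of vectors of even Hamming weight and the set of vectors of odd Hamming weight. $\sigma_k(Q_d)$ denotes $\sigma_k(Q_d,I)$ where $I$ is a parity class (both choices give the same value). *)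

theory Defs
  imports Complex_Main "HOL-Library.Z2"
begin

text \<open>
  A graph is given by its vertex set \<open>V\<close> and its adjacency relation \<open>E\<close>,
  of which only the restriction to \<open>V\<close> matters.
\<close>

definition simple_graph :: "'a set \<Rightarrow> ('a \<Rightarrow> 'a \<Rightarrow> bool) \<Rightarrow> bool" where
  "simple_graph V E \<longleftrightarrow>
     finite V \<and> (\<forall>x\<in>V. \<not> E x x) \<and> (\<forall>x\<in>V. \<forall>y\<in>V. E x y \<longrightarrow> E y x)"

definition independent_set :: "'a set \<Rightarrow> ('a \<Rightarrow> 'a \<Rightarrow> bool) \<Rightarrow> 'a set \<Rightarrow> bool" where
  "independent_set V E I \<longleftrightarrow> I \<subseteq> V \<and> (\<forall>x\<in>I. \<forall>y\<in>I. \<not> E x y)"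

definition open_nbhd :: "'a set \<Rightarrow> ('a \<Rightarrow> 'a \<Rightarrow> bool) \<Rightarrow> 'a \<Rightarrow> 'a set" where
  "open_nbhd V E x = {y \<in> V. E x y}"

definition closed_nbhd :: "'a set \<Rightarrow> ('a \<Rightarrow> 'a \<Rightarrow> bool) \<Rightarrow> 'a \<Rightarrow> 'a set" where
  "closed_nbhd V E x = insert x (open_nbhd V E x)"

definition attack :: "'a set \<Rightarrow> nat \<Rightarrow> 'a set \<Rightarrow> bool" where
  "attack I k S \<longleftrightarrow> S \<subseteq> I \<and> finite S \<and> card S \<le> k"

definition surj_proper_colouring ::
    "'a set \<Rightarrow> ('a \<Rightarrow> 'a \<Rightarrow> bool) \<Rightarrow> nat \<Rightarrow> ('a \<Rightarrow> nat) \<Rightarrow> bool" where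
  "surj_proper_colouring V E q c \<longleftrightarrow>
     c ` V = {1..q} \<and> (\<forall>x\<in>V. \<forall>y\<in>V. E x y \<longrightarrow> c x \<noteq> c y)"

definition colour_class :: "'a set \<Rightarrow> ('a \<Rightarrow> nat) \<Rightarrow> nat \<Rightarrow> 'a set" where
  "colour_class V c i = {v \<in> V. c v = i}"

definition defensive_silver_colouring ::
    "'a set \<Rightarrow> ('a \<Rightarrow> 'a \<Rightarrow> bool) \<Rightarrow> 'a set \<Rightarrow> nat \<Rightarrow> nat \<Rightarrow> ('a \<Rightarrow> nat) \<Rightarrow> bool" where
  "defensive_silver_colouring V E I k q c \<longleftrightarrow>
     surj_proper_colouring V E q c \<and>
     (\<forall>i\<in>{1..q}. \<forall>S. attack I k S \<longrightarrow>
        (\<exists>f. inj_on f S \<and> f ` S \<subseteq> colour_class V c i \<and>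
             (\<forall>x\<in>S. f x \<in> closed_nbhd V E x)))"

text \<open>
  Only meaningful when \<open>(V, E)\<close> is a simple graph, \<open>I\<close> is independent and some
  colouring exists; \<open>Max\<close> is unspecified on the empty set. The existence of a
  colouring for the hypercube is \<open>cube_colouring_exists\<close> below.
\<close>

definition sigma :: "nat \<Rightarrow> 'a set \<Rightarrow> ('a \<Rightarrow> 'a \<Rightarrow> bool) \<Rightarrow> 'a set \<Rightarrow> nat" where
  "sigma k V E I = Max {q. \<exists>c. defensive_silver_colouring V E I k q c}"

lemma finite_colouring_numbers:
  assumes "finite V"
  shows "finite {q. \<exists>c. defensive_silver_colouring V E I k q c}"
proof (rule finite_subset)
  show "{q. \<exists>c. defensive_silver_colouring V E I k q c} \<subseteq> {..card V}"
  proof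
    fix q assume "q \<in> {q. \<exists>c. defensive_silver_colouring V E I k q c}"
    then obtain c where "c ` V = {1..q}"
      by (auto simp: defensive_silver_colouring_def surj_proper_colouring_def)
    then have "q = card (c ` V)" by simp
    also have "\<dots> \<le> card V" using assms by (rule card_image_le)
    finally show "q \<in> {..card V}" by simp
  qed
qed simp

text \<open>Vectors of \<open>\<bbbF>\<^sub>2\<^sup>d\<close> are lists of length \<open>d\<close>, with coordinates \<open>0, \<dots>, d - 1\<close>.\<close>

definition cube_verts :: "nat \<Rightarrow> bit list set" where
  "cube_verts d = {x. length x = d}"

definition cube_adj :: "nat \<Rightarrow> bit list \<Rightarrow> bit list \<Rightarrow> bool" where
  "cube_adj d x y \<longleftrightarrow> card {i. i < d \<and> x ! i \<noteq> y ! i} = 1"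

definition hamming_weight :: "bit list \<Rightarrow> nat" where
  "hamming_weight x = card {i. i < length x \<and> x ! i \<noteq> 0}"

definition even_class :: "nat \<Rightarrow> bit list set" where
  "even_class d = {x \<in> cube_verts d. even (hamming_weight x)}"

definition odd_class :: "nat \<Rightarrow> bit list set" where
  "odd_class d = {x \<in> cube_verts d. odd (hamming_weight x)}"

definition cube_parity_class :: "nat \<Rightarrow> bit list set \<Rightarrow> bool" where
  "cube_parity_class d I \<longleftrightarrow> I = even_class d \<or> I = odd_class d"

lemma finite_cube_verts: "finite (cube_verts d)"
proof -
  have "finite (UNIV :: bit set)"
    by (rule finite_subset[of _ "{0, 1}"]) (auto intro: bit.exhaust)
  from finite_lists_length_eq[OF this, of d] show ?thesis
    by (simp add: cube_verts_def)
qed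

lemma simple_graph_cube: "simple_graph (cube_verts d) (cube_adj d)"
  by (auto simp: simple_graph_def finite_cube_verts cube_adj_def eq_commute)

lemma cube_adj_weight:
  assumes "x \<in> cube_verts d" "y \<in> cube_verts d" "cube_adj d x y"
  shows "even (hamming_weight x) \<longleftrightarrow> odd (hamming_weight y)"
proof -
  obtain j where j: "{i. i < d \<and> x ! i \<noteq> y ! i} = {j}"
    using assms(3) by (auto simp: cube_adj_def card_1_singleton_iff)
  define A where "A = {i. i < d \<and> i \<noteq> j \<and> x ! i \<noteq> 0}"
  have jd: "j < d" "x ! j \<noteq> y ! j" using j by auto
  have same: "x ! i = y ! i" if "i < d" "i \<noteq> j" for i using j that by auto
  have A: "finite A" "j \<notin> A" by (auto simp: A_def)
  have X: "{i. i < d \<and> x ! i \<noteq> 0} = (if x ! j \<noteq> 0 then insert j A else A)"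
  proof (rule set_eqI)
    fix i
    show "i \<in> {i. i < d \<and> x ! i \<noteq> 0} \<longleftrightarrow> i \<in> (if x ! j \<noteq> 0 then insert j A else A)"
      using jd(1) by (cases "i = j") (simp_all add: A_def)
  qed
  have Y: "{i. i < d \<and> y ! i \<noteq> 0} = (if y ! j \<noteq> 0 then insert j A else A)"
  proof (rule set_eqI)
    fix i
    show "i \<in> {i. i < d \<and> y ! i \<noteq> 0} \<longleftrightarrow> i \<in> (if y ! j \<noteq> 0 then insert j A else A)"
      using jd(1) same[of i] by (cases "i = j"; cases "i < d") (simp_all add: A_def)
  qed
  have "(x ! j \<noteq> 0) \<noteq> (y ! j \<noteq> 0)" using jd(2) by (metis bit_not_zero_iff)
  then show ?thesis
    using assms(1,2) X Y A by (auto simp: hamming_weight_def cube_verts_def)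
qed

lemma independent_parity_class:
  assumes "cube_parity_class d I"
  shows "independent_set (cube_verts d) (cube_adj d) I"
  using assms cube_adj_weight
  by (fastforce simp: cube_parity_class_def even_class_def odd_class_def independent_set_def)

lemma cube_colouring_exists:
  assumes "d \<ge> 1" "cube_parity_class d I"
  shows "\<exists>c. defensive_silver_colouring (cube_verts d) (cube_adj d) I k 2 c"
proof -
  let ?V = "cube_verts d" and ?E = "cube_adj d"
  define flip where "flip x = x[0 := x ! 0 + 1]" for x :: "bit list"
  define c where "c x = (if even (hamming_weight x) then 1 else 2 :: nat)" for x
  have bit1: "b + 1 + 1 = b" "b + 1 \<noteq> b" for b :: bit by (cases b; simp)+
  have fV: "flip x \<in> ?V" if "x \<in> ?V" for x
    using that by (simp add: flip_def cube_verts_def)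
  have ff: "flip (flip x) = x" if "x \<in> ?V" for x
    using that assms(1) by (cases x) (auto simp: flip_def cube_verts_def bit1)
  have fE: "?E x (flip x)" if "x \<in> ?V" for x
  proof -
    have "{i. i < d \<and> x ! i \<noteq> flip x ! i} = {0}"
      using that assms(1) bit1(2)[of "x ! 0"]
      by (auto simp: flip_def cube_verts_def nth_list_update split: if_splits)
    then show ?thesis by (simp add: cube_adj_def)
  qed
  have fc: "c (flip x) = 3 - c x" if "x \<in> ?V" for x
    using cube_adj_weight[OF that fV[OF that] fE[OF that]] by (auto simp: c_def)
  have proper: "\<forall>x\<in>?V. \<forall>y\<in>?V. ?E x y \<longrightarrow> c x \<noteq> c y"
    using cube_adj_weight by (auto simp: c_def)
  have z: "replicate d 0 \<in> ?V" by (simp add: cube_verts_def)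
  have "{i. i < d \<and> replicate d (0::bit) ! i \<noteq> 0} = {}" by auto
  then have "hamming_weight (replicate d 0) = 0"
    unfolding hamming_weight_def length_replicate by (simp only: card.empty)
  then have "c (replicate d 0) = 1" by (simp add: c_def)
  with fc[OF z] have two: "c (flip (replicate d 0)) = 2" by simp
  have im: "c ` ?V = {1..2}"
  proof
    show "c ` ?V \<subseteq> {1..2}" by (auto simp: c_def)
    have "i \<in> c ` ?V" if "i \<in> {1..2}" for i
    proof -
      from that have "i = 1 \<or> i = 2" by auto
      then show ?thesis
        using \<open>c (replicate d 0) = 1\<close> two z fV[OF z] by (metis image_eqI)
    qed
    then show "{1..2} \<subseteq> c ` ?V" by blast
  qed
  have I: "I \<subseteq> ?V" "\<exists>j\<in>{1..2}. \<forall>x\<in>I. c x = j"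
    using assms(2) by (auto simp: cube_parity_class_def even_class_def odd_class_def c_def)
  then obtain j where j: "j \<in> {1..2}" "\<forall>x\<in>I. c x = j" by blast
  have "\<exists>f. inj_on f S \<and> f ` S \<subseteq> colour_class ?V c i \<and> (\<forall>x\<in>S. f x \<in> closed_nbhd ?V ?E x)"
    if i: "i \<in> {1..2}" and S: "attack I k S" for i S
  proof (cases "i = j")
    case True
    then show ?thesis using S I(1) j
      by (intro exI[of _ id]) (auto simp: attack_def colour_class_def closed_nbhd_def)
  next
    case False
    with i j(1) have "i = 3 - j" by auto
    moreover have SV: "x \<in> ?V" "c x = j" if "x \<in> S" for x
      using S I(1) j(2) that by (auto simp: attack_def)
    moreover have "inj_on flip S" using SV(1) ff by (intro inj_onI) metis
    ultimately show ?thesis using fc fV fE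
      by (intro exI[of _ flip]) (auto simp: colour_class_def closed_nbhd_def open_nbhd_def)
  qed
  with proper im show ?thesis
    by (auto simp: defensive_silver_colouring_def surj_proper_colouring_def intro!: exI[of _ c])
qed

end

theory Submission
  imports Defs
begin

text \<open>
  Call a neighbour \<open>y\<close> of \<open>x\<close> solitary if no other neighbour of \<open>x\<close> has the colour of \<open>y\<close>.
  A solitary neighbour of \<open>x \<in> I\<close> is the only possible defender of \<open>x\<close> in its colour, since
  \<open>x\<close> itself has another colour. So no vertex \<open>y\<close> is a solitary neighbour of two vertices
  \<open>x, x'\<close> of \<open>I\<close>: both would need \<open>y\<close> as defender against the attack \<open>{x, x'}\<close>. This is
  the only use of attacks of size two.

  Solitary neighbours of vertices of \<open>I\<close> lie outside \<open>I\<close>, and the two parity classes of the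
  cube have the same size. Hence the vertices of \<open>I\<close> have on average at most one solitary
  neighbour, and some \<open>x \<in> I\<close> has at most one. Attacking \<open>x\<close> alone shows that each of the
  \<open>q - 1\<close> colours other than the colour of \<open>x\<close> occurs in \<open>N(x)\<close>. All of these colours but at
  most one occur at least twice among the \<open>d\<close> neighbours, which gives
  \<open>2 * (q - 1) \<le> d + 1\<close>. The argument works in every finite graph with an independent set \<open>I\<close>
  that is nonempty, contains at least half of the vertices and has only vertices of degree at
  most \<open>d\<close>
  (\<open>defensive_colours_le\<close>).
\<close>

text \<open>
  A value of \<open>f\<close> that is taken once accounts for one point of \<open>A\<close> and one point of the last
  set, and any other value accounts for at least two points of \<open>A\<close>.
\<close>

lemma double_card_image_le:
  assumes "finite A"
  shows "2 * card (f ` A) \<le> card A + card {y \<in> A. \<forall>z\<in>A. f z = f y \<longrightarrow> z = y}"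
proof -
  define B where "B = {y \<in> A. \<forall>z\<in>A. f z = f y \<longrightarrow> z = y}"
  define C where "C = A - B"
  have fin: "finite B" "finite C" and A: "A = B \<union> C" "B \<inter> C = {}"
    using assms by (auto simp: B_def C_def)
  have fibre: "2 \<le> card {y \<in> C. f y = v}" if "v \<in> f ` C" for v
  proof -
    obtain y where y: "y \<in> C" "f y = v" using \<open>v \<in> f ` C\<close> by blast
    then obtain z where "z \<in> A" "f z = f y" "z \<noteq> y" by (auto simp: B_def C_def)
    moreover have "z \<in> C" using calculation y by (auto simp: B_def C_def)
    ultimately have "{y, z} \<subseteq> {y \<in> C. f y = v}" using y by auto
    then have "card {y, z} \<le> card {y \<in> C. f y = v}" using fin by (intro card_mono) auto
    then show ?thesis using \<open>z \<noteq> y\<close> by simp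
  qed
  have "2 * card (f ` C) = (\<Sum>v\<in>f ` C. 2)" by simp
  also have "\<dots> \<le> (\<Sum>v\<in>f ` C. card {y \<in> C. f y = v})" using fibre by (rule sum_mono)
  also have "\<dots> = card C"
    using sum.image_gen[OF fin(2), of "\<lambda>_. 1::nat" f] by simp
  finally have C: "2 * card (f ` C) \<le> card C" .
  have "card (f ` A) \<le> card (f ` B) + card (f ` C)"
    unfolding A(1) image_Un by (rule card_Un_le)
  moreover have "card (f ` B) \<le> card B" using fin(1) by (rule card_image_le)
  moreover have "card A = card B + card C"
    using A fin by (metis card_Un_disjoint)
  ultimately show ?thesis using C unfolding B_def[symmetric] by linarith
qed

definition solitary_nbrs ::
    "'a set \<Rightarrow> ('a \<Rightarrow> 'a \<Rightarrow> bool) \<Rightarrow> ('a \<Rightarrow> nat) \<Rightarrow> 'a \<Rightarrow> 'a set" where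
  "solitary_nbrs V E c x =
     {y \<in> open_nbhd V E x. \<forall>z\<in>open_nbhd V E x. c z = c y \<longrightarrow> z = y}"

lemma solitary_nbrs_disjoint:
  assumes "defensive_silver_colouring V E I k q c" "I \<subseteq> V" "k \<ge> 2"
    and "x \<in> I" "x' \<in> I" "x \<noteq> x'"
  shows "solitary_nbrs V E c x \<inter> solitary_nbrs V E c x' = {}"
proof (rule ccontr)
  assume "\<not> ?thesis"
  then obtain y where y: "y \<in> solitary_nbrs V E c x" "y \<in> solitary_nbrs V E c x'" by blast
  have col: "c ` V = {1..q}" "\<forall>x\<in>V. \<forall>y\<in>V. E x y \<longrightarrow> c x \<noteq> c y"
    using assms(1) by (auto simp: defensive_silver_colouring_def surj_proper_colouring_def)
  have yV: "y \<in> V" using y by (auto simp: solitary_nbrs_def open_nbhd_def)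
  then have "c y \<in> {1..q}" using col(1) by blast
  moreover have "attack I k {x, x'}" using assms by (auto simp: attack_def)
  ultimately obtain f where f: "inj_on f {x, x'}" "f ` {x, x'} \<subseteq> colour_class V c (c y)"
      "\<forall>u\<in>{x, x'}. f u \<in> closed_nbhd V E u"
    using assms(1) unfolding defensive_silver_colouring_def by blast
  have "f u = y" if u: "u \<in> {x, x'}" for u
  proof -
    have s: "y \<in> solitary_nbrs V E c u" "u \<in> V" using u y assms by auto
    then have "c u \<noteq> c y" using col(2) yV by (auto simp: solitary_nbrs_def open_nbhd_def)
    moreover have "c (f u) = c y" using f(2) u by (auto simp: colour_class_def)
    ultimately have "f u \<in> open_nbhd V E u" using f(3) u by (auto simp: closed_nbhd_def)
    then show ?thesis using s \<open>c (f u) = c y\<close> by (auto simp: solitary_nbrs_def)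
  qed
  then show False using f(1) assms(6) by (auto simp: inj_on_def)
qed

lemma colours_in_nbhd:
  assumes "defensive_silver_colouring V E I k q c" "k \<ge> 1" "x \<in> I"
  shows "{1..q} - {c x} \<subseteq> c ` open_nbhd V E x"
proof
  fix i assume i: "i \<in> {1..q} - {c x}"
  have "attack I k {x}" using assms by (auto simp: attack_def)
  then obtain f where "f ` {x} \<subseteq> colour_class V c i" "\<forall>u\<in>{x}. f u \<in> closed_nbhd V E u"
    using assms(1) i unfolding defensive_silver_colouring_def by blast
  then show "i \<in> c ` open_nbhd V E x"
    using i by (auto simp: colour_class_def closed_nbhd_def)
qed

theorem defensive_colours_le:
  assumes "defensive_silver_colouring V E I k q c" "k \<ge> 2"
    and "finite V" "independent_set V E I" "I \<noteq> {}"
    and half: "card (V - I) \<le> card I"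
    and degree: "\<And>x. x \<in> I \<Longrightarrow> card (open_nbhd V E x) \<le> d"
  shows "2 * q \<le> d + 3"
proof -
  let ?S = "solitary_nbrs V E c"
  have IV: "I \<subseteq> V" "finite I"
    using assms(3,4) by (auto simp: independent_set_def intro: finite_subset)
  have S: "?S x \<subseteq> V - I" if "x \<in> I" for x
    using assms(4) that by (auto simp: solitary_nbrs_def open_nbhd_def independent_set_def)
  have "\<exists>x\<in>I. card (?S x) \<le> 1"
  proof (rule ccontr)
    assume "\<not> ?thesis"
    then have "(\<Sum>x\<in>I. 2) \<le> (\<Sum>x\<in>I. card (?S x))"
      by (intro sum_mono) (simp add: not_le numeral_2_eq_2 Suc_le_eq)
    also have "\<dots> = card (\<Union>x\<in>I. ?S x)"
      using IV(2) S assms(3) solitary_nbrs_disjoint[OF assms(1) IV(1) assms(2)]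
      by (intro card_UN_disjoint[symmetric]) (blast intro: finite_subset finite_Diff)+
    also have "\<dots> \<le> card (V - I)" using S assms(3) by (intro card_mono) auto
    finally have "card I * 2 \<le> card (V - I)" by simp
    moreover have "0 < card I" using IV(2) assms(5) by (simp add: card_gt_0_iff)
    ultimately show False using half by linarith
  qed
  then obtain x where x: "x \<in> I" "card (?S x) \<le> 1" by blast
  have fin: "finite (open_nbhd V E x)" using assms(3) by (simp add: open_nbhd_def)
  have "q - 1 \<le> card ({1..q} - {c x})" using diff_card_le_card_Diff[of "{c x}" "{1..q}"] by simp
  also have "\<dots> \<le> card (c ` open_nbhd V E x)"
    using colours_in_nbhd[OF assms(1) _ x(1)] assms(2) fin by (intro card_mono) auto
  finally have "2 * (q - 1) \<le> card (open_nbhd V E x) + card (?S x)"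
    using double_card_image_le[OF fin, of c] unfolding solitary_nbrs_def by linarith
  then show ?thesis using degree[OF x(1)] x(2) by linarith
qed

lemma bit_add_one_eq_iff: "b + 1 = b' \<longleftrightarrow> b \<noteq> b'" for b b' :: bit
  by (cases b; cases b') simp_all

lemma card_cube_nbhd_le:
  assumes "x \<in> cube_verts d"
  shows "card (open_nbhd (cube_verts d) (cube_adj d) x) \<le> d"
proof -
  have "open_nbhd (cube_verts d) (cube_adj d) x \<subseteq> (\<lambda>j. x[j := x ! j + 1]) ` {..<d}"
  proof
    fix y assume y: "y \<in> open_nbhd (cube_verts d) (cube_adj d) x"
    then obtain j where j: "{i. i < d \<and> x ! i \<noteq> y ! i} = {j}"
      by (auto simp: open_nbhd_def cube_adj_def card_1_singleton_iff)
    have len: "length x = d" "length y = d"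
      using y assms by (auto simp: open_nbhd_def cube_verts_def)
    have jd: "j < d" "x ! j + 1 = y ! j" using j unfolding bit_add_one_eq_iff by blast+
    have same: "x ! i = y ! i" if "i < d" "i \<noteq> j" for i using j that by blast
    have "y = x[j := x ! j + 1]"
    proof (rule nth_equalityI)
      fix i assume "i < length y"
      then show "y ! i = x[j := x ! j + 1] ! i"
        using jd same[of i] len by (cases "i = j") simp_all
    qed (simp add: len)
    then show "y \<in> (\<lambda>j. x[j := x ! j + 1]) ` {..<d}" using jd(1) by blast
  qed
  then show ?thesis using surj_card_le[of "{..<d}"] by simp
qed

text \<open>Flipping the first coordinate exchanges the two parity classes.\<close>

lemma parity_class_at_least_half:
  assumes "d \<ge> 1" "cube_parity_class d I"
  shows "card (cube_verts d - I) \<le> card I" "I \<noteq> {}"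
proof -
  define flip where "flip x = x[0 := x ! 0 + 1]" for x :: "bit list"
  have fV: "flip x \<in> cube_verts d" if "x \<in> cube_verts d" for x
    using that by (simp add: flip_def cube_verts_def)
  have ff: "flip (flip x) = x" if "x \<in> cube_verts d" for x
    using that assms(1) by (cases x) (auto simp: flip_def cube_verts_def bit_add_one_eq_iff)
  have adj: "cube_adj d x (flip x)" if "x \<in> cube_verts d" for x
  proof -
    have "{i. i < d \<and> x ! i \<noteq> flip x ! i} = {0}"
      using that assms(1) bit_add_one_eq_iff[of "x ! 0" "x ! 0"]
      by (auto simp: flip_def cube_verts_def nth_list_update split: if_splits)
    then show ?thesis by (simp add: cube_adj_def)
  qed
  have into: "flip x \<in> I" if "x \<in> cube_verts d - I" for x
    using that assms(2) fV[of x] cube_adj_weight[OF _ fV adj, of x]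
    by (auto simp: cube_parity_class_def even_class_def odd_class_def)
  have "I \<subseteq> cube_verts d"
    using assms(2) by (auto simp: cube_parity_class_def even_class_def odd_class_def)
  then have "finite I" using finite_cube_verts by (rule finite_subset)
  then show "card (cube_verts d - I) \<le> card I"
    using into ff by (intro card_inj_on_le[of flip]) (auto intro!: inj_on_inverseI[of _ flip])
  have "replicate d 0 \<in> cube_verts d" by (simp add: cube_verts_def)
  then show "I \<noteq> {}" using into by blast
qed

theorem corollary3p3:
  fixes d k :: nat and I :: "bit list set"
  assumes "d \<ge> 1" and "k \<ge> 2" and "cube_parity_class d I"
  shows "int (sigma k (cube_verts d) (cube_adj d) I) \<le> \<lfloor>(real d + 3) / 2\<rfloor>"
proof -
  let ?Q = "{q. \<exists>c. defensive_silver_colouring (cube_verts d) (cube_adj d) I k q c}"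
  \<comment> \<open>The finite set \<open>?Q\<close> contains 2, so the maximum that defines \<open>sigma\<close> is attained.\<close>
  have "Max ?Q \<in> ?Q"
    using finite_colouring_numbers[OF finite_cube_verts] cube_colouring_exists[OF assms(1,3)]
    by (intro Max_in) blast+
  then obtain c where c: "defensive_silver_colouring (cube_verts d) (cube_adj d) I k
      (sigma k (cube_verts d) (cube_adj d) I) c"
    unfolding sigma_def by blast
  have I: "independent_set (cube_verts d) (cube_adj d) I"
    using assms(3) by (rule independent_parity_class)
  then have "card (open_nbhd (cube_verts d) (cube_adj d) x) \<le> d" if "x \<in> I" for x
    using that by (intro card_cube_nbhd_le) (auto simp: independent_set_def)
  then have "2 * sigma k (cube_verts d) (cube_adj d) I \<le> d + 3"
    using defensive_colours_le[OF c assms(2) finite_cube_verts I]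
      parity_class_at_least_half[OF assms(1,3)] by blast
  then show ?thesis by (simp add: le_floor_iff)
qed

end
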